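(* For each integer $n\ge 1$, let $\lambda_n$ be the largest constant in $[0,1]$ for which $\lambda_n M+(1-\lambda_n)W_n\in \mathcal{B}_n^h$ for all $n\times n$ symmetric bistochastic matrices $M$. Then $\lambda_1=\lambda_2=1$ and $\lambda_3=\lambda_4=\frac{2}{3}$.
   Context: A bistochastic (doubly stochastic) matrix is a square real matrix with nonnegative entries all of whose rows and columns sum to $1$; a symmetric bistochastic matrix is one that is also symmetric. $W_n$ denotes the $n\times n$ matrix all of whose entries are $\frac{1}{n}$. An $n\times n$ matrix is $H$-unistochastic if its $(i,j)$ entry is $|u_{ij}|^2$ for all $i,j$, where $U=(u_{ij})$ is some $n\times n$ complex matrix that is both Hermitian and unitary. $\mathcal{B}_n^h$ denotes the convex hull of the set of $n\times n$ $H$-unistochastic matrices. *)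

theory Defs
  imports "HOL-Analysis.Analysis"
begin

text \<open>An $n \times n$ matrix is a term of type \<open>_ ^'n^'n\<close> with \<open>CARD('n) = n\<close>; since types are
  nonempty, $n \ge 1$ holds automatically.\<close>

definition bistochastic :: "real^'n^'n \<Rightarrow> bool" where
  "bistochastic M \<longleftrightarrow>
     (\<forall>i j. 0 \<le> M $ i $ j) \<and>
     (\<forall>i. (\<Sum>j\<in>UNIV. M $ i $ j) = 1) \<and>
     (\<forall>j. (\<Sum>i\<in>UNIV. M $ i $ j) = 1)"

definition symmetric_bistochastic :: "real^'n^'n \<Rightarrow> bool" where
  "symmetric_bistochastic M \<longleftrightarrow> bistochastic M \<and> transpose M = M"

definition W_matrix :: "real^'n^'n" where
  "W_matrix = (\<chi> i j. 1 / real CARD('n))"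

definition conj_transpose :: "complex^'n^'n \<Rightarrow> complex^'n^'n" where
  "conj_transpose U = (\<chi> i j. cnj (U $ j $ i))"

definition hermitian_matrix :: "complex^'n^'n \<Rightarrow> bool" where
  "hermitian_matrix U \<longleftrightarrow> conj_transpose U = U"

definition unitary_matrix :: "complex^'n^'n \<Rightarrow> bool" where
  "unitary_matrix U \<longleftrightarrow> U ** conj_transpose U = mat 1 \<and> conj_transpose U ** U = mat 1"

definition H_unistochastic :: "real^'n^'n \<Rightarrow> bool" where
  "H_unistochastic M \<longleftrightarrow>
     (\<exists>U :: complex^'n^'n. hermitian_matrix U \<and> unitary_matrix U \<and>
        (\<forall>i j. M $ i $ j = (cmod (U $ i $ j))\<^sup>2))"

definition Bh :: "(real^'n^'n) set" where
  "Bh = convex hull {M. H_unistochastic M}"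

definition admissible_constants :: "'n::finite itself \<Rightarrow> real set" where
  "admissible_constants _ =
     {t \<in> {0..1}. \<forall>M :: real^'n^'n. symmetric_bistochastic M \<longrightarrow>
        t *\<^sub>R M + (1 - t) *\<^sub>R W_matrix \<in> Bh}"

text \<open>\<^const>\<open>Greatest\<close> yields the maximum only when one exists, so statements about the constant
  below should also assert that it is an admissible upper bound.\<close>

definition lambda_const :: "'n::finite itself \<Rightarrow> real" where
  "lambda_const n = (GREATEST t. t \<in> admissible_constants n)"

end

theory Submission
  imports Defs
begin

text \<open>
  Upper bound. If \<open>U\<close> is Hermitian and unitary then \<open>(1 + U) / 2\<close> is an orthogonal projection, whose
  trace is a natural number; hence the trace of \<open>U\<close> is an integer congruent to \<open>n\<close> modulo 2. The
  diagonal entries \<open>d\<^sub>i\<close> of \<open>U\<close> are real with modulus at most 1, and the diagonal of the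
  H-unistochastic matrix is \<open>d\<^sub>i\<^sup>2\<close>. For \<open>n = 3\<close> the trace is odd, so Cauchy--Schwarz gives
  \<open>d\<^sub>1\<^sup>2 + d\<^sub>2\<^sup>2 + d\<^sub>3\<^sup>2 \<ge> 1/3\<close>. For \<open>n = 4\<close> the trace is even, so
  \<open>d\<^sub>1 + d\<^sub>2 + d\<^sub>3\<close> is an even integer minus \<open>d\<^sub>4\<close>, of modulus at least \<open>\<bar>d\<^sub>4\<bar>\<close>, and Cauchy--Schwarz gives
  \<open>d\<^sub>4\<^sup>2 \<le> 3 (d\<^sub>1\<^sup>2 + d\<^sub>2\<^sup>2 + d\<^sub>3\<^sup>2)\<close>. Both inequalities are linear in the
  H-unistochastic matrix, so they hold on the whole convex hull (\<open>diagonal_bound_3\<close>,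
  \<open>diagonal_bound_4\<close>). Tested on the matrix \<open>T\<close> that is 1/2 off the diagonal of a \<open>3 \<times> 3\<close> block, 0 on
  the diagonal of that block, and the identity elsewhere, they force the constant to be at most 2/3.

  Lower bound. A symmetric matrix with unit row sums is \<open>1 - \<Sum> m\<^sub>i\<^sub>j L\<^sub>i\<^sub>j\<close>, summed over the edges
  \<open>ij\<close> of the complete graph, with \<open>L\<^sub>i\<^sub>j\<close> the Laplacian of the edge; if its entries are nonnegative,
  the weights \<open>m\<^sub>i\<^sub>j\<close> form a fractional matching. On four vertices one subtracts from each of the three perfect
  matchings the smaller of its two weights. What is left is supported on one edge of each perfect
  matching, that is, on a star or on a triangle. A star decomposes into single edges; a triangle
  decomposes into single edges and a matrix of the form \<open>T\<close> (\<open>tetrahedron_in_cone\<close>). On three vertices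
  there is only the triangle, on two a single edge. The matchings are symmetric permutation matrices, which are
  H-unistochastic, and \<open>2/3 T + 1/3 W\<close> is H-unistochastic by an explicit choice of \<open>U\<close>
  (\<open>shrunk_half_triangle_in_Bh_3\<close>, \<open>shrunk_half_triangle_in_Bh_4\<close>).

  Existence of the maximum for all \<open>n\<close>. The H-unistochastic matrices form a compact set, hence so do
  its convex hull and the set of admissible constants. The latter contains 0 because \<open>W\<close> is an
  average of symmetric permutation matrices.
\<close>

section \<open>H-unistochastic matrices and their convex hull\<close>

lemma H_unistochasticI:
  fixes U :: "complex^'n^'n"
  assumes "\<And>i j. cnj (U $ j $ i) = U $ i $ j"
    and "\<And>i j. (\<Sum>k\<in>UNIV. U $ i $ k * U $ k $ j) = (if i = j then 1 else 0)"
    and "\<And>i j. M $ i $ j = (cmod (U $ i $ j))\<^sup>2"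
  shows "H_unistochastic M"
proof -
  have "conj_transpose U = U"
    by (simp add: conj_transpose_def vec_eq_iff assms(1))
  moreover have "U ** U = mat 1"
    by (simp add: matrix_matrix_mult_def mat_def vec_eq_iff assms(2))
  ultimately show ?thesis
    unfolding H_unistochastic_def hermitian_matrix_def unitary_matrix_def
    using assms(3) by metis
qed

lemma row_sum_of_hermitian_unitary:
  fixes U :: "complex^'n^'n"
  assumes "hermitian_matrix U" "unitary_matrix U"
  shows "(\<Sum>j\<in>UNIV. (cmod (U $ i $ j))\<^sup>2) = 1"
proof -
  have "(U ** conj_transpose U) $ i $ i = 1"
    using assms(2) by (simp add: unitary_matrix_def mat_def)
  hence "(\<Sum>j\<in>UNIV. complex_of_real ((cmod (U $ i $ j))\<^sup>2)) = 1"
    by (simp add: matrix_matrix_mult_def conj_transpose_def complex_norm_square del: of_real_power)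
  hence "complex_of_real (\<Sum>j\<in>UNIV. (cmod (U $ i $ j))\<^sup>2) = 1" by simp
  thus ?thesis using of_real_eq_1_iff by blast
qed

lemma row_sum_of_H_unistochastic:
  "H_unistochastic M \<Longrightarrow> (\<Sum>j\<in>UNIV. M $ i $ j) = 1"
  unfolding H_unistochastic_def using row_sum_of_hermitian_unitary by fastforce

text \<open>A linear inequality passes from the H-unistochastic matrices to their convex hull because it
  cuts out a convex set.\<close>

lemma entry_sum_bound_on_Bh:
  fixes w :: "'n::finite \<Rightarrow> 'n \<Rightarrow> real"
  assumes "\<And>M. H_unistochastic M \<Longrightarrow> c \<le> (\<Sum>i\<in>UNIV. \<Sum>j\<in>UNIV. w i j * M $ i $ j)"
    and "M \<in> Bh"
  shows "c \<le> (\<Sum>i\<in>UNIV. \<Sum>j\<in>UNIV. w i j * M $ i $ j)"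
proof -
  let ?L = "\<lambda>M :: real^'n^'n. \<Sum>i\<in>UNIV. \<Sum>j\<in>UNIV. w i j * M $ i $ j"
  have lin: "linear ?L"
    by (rule linearI) (simp_all add: algebra_simps sum.distrib sum_distrib_left)
  have "convex (?L -` {c..})"
    by (rule convex_linear_vimage[OF lin]) simp
  hence "convex hull {M. H_unistochastic M} \<subseteq> ?L -` {c..}"
    by (intro hull_minimal) (use assms(1) in auto)
  thus ?thesis using assms(2) by (auto simp: Bh_def)
qed

lemma row_sum_of_Bh:
  assumes "M \<in> Bh" shows "(\<Sum>j\<in>UNIV. M $ i $ j) = 1"
proof -
  have pick: "(\<Sum>k\<in>UNIV. \<Sum>j\<in>UNIV. (if k = i then r else 0) * N $ k $ j)
        = r * (\<Sum>j\<in>UNIV. N $ i $ j)" for N :: "real^'a^'a" and r :: real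
  proof -
    have "(\<Sum>k\<in>UNIV. \<Sum>j\<in>UNIV. (if k = i then r else 0) * N $ k $ j)
        = (\<Sum>k\<in>UNIV. if k = i then r * (\<Sum>j\<in>UNIV. N $ i $ j) else 0)"
      by (intro sum.cong) (auto simp: sum_distrib_left)
    thus ?thesis by simp
  qed
  \<comment> \<open>The equation is the conjunction of two linear inequalities.\<close>
  have "1 \<le> (\<Sum>k\<in>UNIV. \<Sum>j\<in>UNIV. (if k = i then 1 else 0) * M $ k $ j)"
    by (rule entry_sum_bound_on_Bh[OF _ assms]) (simp only: pick, simp add: row_sum_of_H_unistochastic)
  moreover have "-1 \<le> (\<Sum>k\<in>UNIV. \<Sum>j\<in>UNIV. (if k = i then -1 else 0) * M $ k $ j)"
    by (rule entry_sum_bound_on_Bh[OF _ assms]) (simp only: pick, simp add: row_sum_of_H_unistochastic)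
  ultimately show ?thesis unfolding pick by simp
qed

lemma H_unistochastic_imp_Bh: "H_unistochastic M \<Longrightarrow> M \<in> Bh"
  by (simp add: Bh_def hull_inc)

lemma convex_Bh: "convex Bh"
  by (simp add: Bh_def convex_convex_hull)

lemma involution_matrix_in_Bh:
  assumes "\<And>i. p (p i) = i"
  shows "(\<chi> i j. if j = p i then 1 else 0) \<in> Bh"
proof (rule H_unistochastic_imp_Bh, rule H_unistochasticI)
  let ?U = "(\<chi> i j. if j = p i then 1 else 0) :: complex^'a^'a"
  show "cnj (?U $ j $ i) = ?U $ i $ j" for i j
    using assms by auto
  show "(\<Sum>k\<in>UNIV. ?U $ i $ k * ?U $ k $ j) = (if i = j then 1 else 0)" for i j
  proof -
    have "(\<Sum>k\<in>UNIV. ?U $ i $ k * ?U $ k $ j) = (\<Sum>k\<in>UNIV. if k = p i then ?U $ k $ j else 0)"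
      by (intro sum.cong) auto
    also have "\<dots> = (if i = j then 1 else 0)" using assms by (auto simp: sum.delta)
    finally show ?thesis .
  qed
  show "(\<chi> i j. if j = p i then 1 else 0) $ i $ j = (cmod (?U $ i $ j))\<^sup>2" for i j
    by simp
qed

text \<open>Number the indices by residues modulo \<open>n\<close>. The reflections \<open>x \<mapsto> s - x\<close> are involutions, and
  every pair \<open>(x, y)\<close> lies on the graph of exactly one of them, namely \<open>s = x + y\<close>; so the average
  of their \<open>n\<close> permutation matrices has all entries \<open>1/n\<close>.\<close>

lemma W_matrix_in_Bh: "(W_matrix :: real^'n^'n) \<in> Bh"
proof -
  define n where "n = CARD('n)"
  have n: "n > 0" by (simp add: n_def)
  obtain f :: "'n \<Rightarrow> nat" where f: "bij_betw f UNIV {0..<n}"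
    using ex_bij_betw_finite_nat[of "UNIV :: 'n set"] by (auto simp: n_def)
  have f_less: "f i < n" for i using f by (auto simp: bij_betw_def)
  have inj: "f i = f j \<longleftrightarrow> i = j" for i j using f by (auto simp: bij_betw_def inj_on_def)
  \<comment> \<open>\<open>n - f i\<close> stands for \<open>- f i\<close>: it avoids truncated subtraction because \<open>f i < n\<close>.\<close>
  define p where "p s i = inv_into UNIV f ((s + (n - f i)) mod n)" for s i
  have fp: "f (p s i) = (s + (n - f i)) mod n" for s i
    unfolding p_def using f n by (intro f_inv_into_f) (auto simp: bij_betw_def)
  have p_iff: "j = p s i \<longleftrightarrow> (f i + f j) mod n = s" if s: "s < n" for s i j
  proof -
    have "j = p s i \<longleftrightarrow> f j = (s + (n - f i)) mod n"
      using fp inj by metis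
    also have "\<dots> \<longleftrightarrow> (f i + f j) mod n = s"
    proof
      assume "f j = (s + (n - f i)) mod n"
      hence "(f i + f j) mod n = (f i + (s + (n - f i))) mod n" by (simp add: mod_simps)
      also have "\<dots> = (s + n) mod n" using f_less[of i] by simp
      finally show "(f i + f j) mod n = s" using s by simp
    next
      assume "(f i + f j) mod n = s"
      hence "(s + (n - f i)) mod n = (f i + f j + (n - f i)) mod n" by (auto simp: mod_simps)
      also have "\<dots> = (f j + n) mod n" using f_less[of i] by (simp add: algebra_simps)
      finally show "f j = (s + (n - f i)) mod n" using f_less[of j] by simp
    qed
    finally show ?thesis .
  qed
  have invol: "p s (p s i) = i" if "s < n" for s i
    using p_iff[OF that] by (metis add.commute)
  let ?P = "\<lambda>s. (\<chi> i j. if j = p s i then 1 else 0) :: real^'n^'n"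
  have "(\<Sum>s\<in>{0..<n}. (1 / real n) *\<^sub>R ?P s) \<in> Bh"
    using n invol by (intro convex_sum convex_Bh involution_matrix_in_Bh) auto
  moreover have "(\<Sum>s\<in>{0..<n}. (1 / real n) *\<^sub>R ?P s) = W_matrix"
  proof -
    have "(\<Sum>s\<in>{0..<n}. (1 / real n) *\<^sub>R ?P s) $ i $ j = 1 / real n" for i j
    proof -
      have "(\<Sum>s\<in>{0..<n}. (1 / real n) *\<^sub>R ?P s) $ i $ j
          = (\<Sum>s\<in>{0..<n}. if s = (f i + f j) mod n then 1 / real n else 0)"
        unfolding sum_component by (intro sum.cong) (auto simp: p_iff)
      also have "\<dots> = 1 / real n" using n by (subst sum.delta) auto
      finally show ?thesis .
    qed
    thus ?thesis by (simp add: vec_eq_iff W_matrix_def n_def)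
  qed
  ultimately show ?thesis by simp
qed

section \<open>The largest admissible constant exists\<close>

text \<open>The Hermitian unitary matrices form a closed set, bounded since their rows are unit vectors,
  and taking squared moduli entrywise is continuous.\<close>

lemma compact_H_unistochastic: "compact {M :: real^'n^'n. H_unistochastic M}"
proof -
  let ?S = "{U :: complex^'n^'n. hermitian_matrix U \<and> unitary_matrix U}"
  have c: "continuous_on UNIV (conj_transpose :: complex^'n^'n \<Rightarrow> _)"
    unfolding conj_transpose_def by (intro continuous_intros)
  have "closed ?S"
    unfolding hermitian_matrix_def unitary_matrix_def matrix_matrix_mult_def
    by (intro closed_Collect_conj closed_Collect_eq continuous_intros c)
  moreover have "bounded ?S"
  proof -
    have "norm U \<le> real CARD('n) * real CARD('n)" if "U \<in> ?S" for U
    proof -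
      have "cmod (U $ i $ j) \<le> 1" for i j
      proof -
        have "(cmod (U $ i $ j))\<^sup>2 \<le> (\<Sum>j\<in>UNIV. (cmod (U $ i $ j))\<^sup>2)"
          by (rule member_le_sum) auto
        thus ?thesis using that row_sum_of_hermitian_unitary[of U i]
          by (simp add: power_le_one_iff abs_square_le_1)
      qed
      hence "norm (U $ i) \<le> real CARD('n)" for i
        using norm_le_l1_cart sum_bounded_above
        by (metis (no_types, lifting) L2_set_le_sum norm_ge_zero norm_vec_def order_trans mult.right_neutral)
      moreover have "norm U \<le> (\<Sum>i\<in>UNIV. norm (U $ i))"
        by (simp add: norm_vec_def L2_set_le_sum)
      ultimately show ?thesis
        using sum_bounded_above[of UNIV "\<lambda>i. norm (U $ i)" "real CARD('n)"] by fastforce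
    qed
    thus ?thesis unfolding bounded_iff by blast
  qed
  ultimately have "compact ?S" using compact_eq_bounded_closed by blast
  hence "compact ((\<lambda>U. (\<chi> i j. (cmod (U $ i $ j))\<^sup>2) :: real^'n^'n) ` ?S)"
    by (intro compact_continuous_image continuous_intros)
  moreover have "{M :: real^'n^'n. H_unistochastic M} = (\<lambda>U. \<chi> i j. (cmod (U $ i $ j))\<^sup>2) ` ?S"
    by (auto simp: H_unistochastic_def vec_eq_iff image_iff)
  ultimately show ?thesis by simp
qed

lemma closed_Bh: "closed (Bh :: (real^'n^'n) set)"
  unfolding Bh_def by (intro compact_imp_closed compact_convex_hull compact_H_unistochastic)

lemma compact_admissible_constants: "compact (admissible_constants TYPE('n::finite))"
proof -
  have "admissible_constants TYPE('n) = {0..1} \<inter>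
     (\<Inter>M \<in> {M :: real^'n^'n. symmetric_bistochastic M}.
        (\<lambda>t. t *\<^sub>R M + (1 - t) *\<^sub>R W_matrix) -` Bh)"
    by (auto simp: admissible_constants_def)
  moreover have "closed ((\<lambda>t. t *\<^sub>R M + (1 - t) *\<^sub>R W_matrix) -` Bh)" for M :: "real^'n^'n"
    by (intro closed_vimage closed_Bh continuous_intros)
  ultimately show ?thesis by (auto intro!: compact_Int_closed closed_INT)
qed

lemma zero_admissible: "0 \<in> admissible_constants TYPE('n::finite)"
  by (simp add: admissible_constants_def W_matrix_in_Bh)

lemma lambda_constI:
  assumes "t \<in> admissible_constants TYPE('n::finite)"
    and "\<And>s. s \<in> admissible_constants TYPE('n) \<Longrightarrow> s \<le> t"
  shows "lambda_const TYPE('n) = t"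
  unfolding lambda_const_def using assms by (intro Greatest_equality) auto

lemma lambda_const_is_greatest:
  "lambda_const TYPE('n::finite) \<in> admissible_constants TYPE('n) \<and>
   (\<forall>t \<in> admissible_constants TYPE('n). t \<le> lambda_const TYPE('n))"
proof -
  obtain m where "m \<in> admissible_constants TYPE('n)"
    "\<And>t. t \<in> admissible_constants TYPE('n) \<Longrightarrow> t \<le> m"
    using compact_attains_sup[OF compact_admissible_constants] zero_admissible by blast
  thus ?thesis using lambda_constI by metis
qed

section \<open>Traces of Hermitian unitary matrices and diagonal bounds\<close>

text \<open>This is \<open>v v\<^sup>*\<close>, for a unit vector \<open>v\<close> the orthogonal projection onto its span.\<close>

definition rank_one :: "complex^'n \<Rightarrow> complex^'n^'n" where
  "rank_one v = (\<chi> i j. v $ i * cnj (v $ j))"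

text \<open>Deflation: if \<open>P \<noteq> 0\<close>, a normalised nonzero column \<open>v\<close> of \<open>P\<close> satisfies \<open>P v = v\<close>, and
  \<open>P - v v\<^sup>*\<close> is again a projection, with trace smaller by 1. The trace of a projection is the
  sum of its squared moduli and so never negative, which bounds the number of steps. This avoids
  dimensions and eigenvalues.\<close>

lemma trace_of_projection_nat:
  fixes P :: "complex^'n^'n"
  assumes "hermitian_matrix P" "P ** P = P"
  shows "\<exists>k::nat. trace P = of_nat k"
proof -
  have main: "\<exists>k::nat. trace P = of_nat k"
    if "hermitian_matrix P" "P ** P = P" "Re (trace P) < real m" for m and P :: "complex^'n^'n"
    using that
  proof (induction m arbitrary: P)
    \<comment> \<open>With bound 0 the hypothesis contradicts that the trace is nonnegative.\<close>
    case (0 P)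
    have herm: "cnj (P $ j $ i) = P $ i $ j" for i j
      using 0(1) by (auto simp: hermitian_matrix_def conj_transpose_def vec_eq_iff)
    have "Re (P $ i $ i) \<ge> 0" for i
    proof -
      have "P $ i $ i = (P ** P) $ i $ i" using 0(2) by simp
      also have "\<dots> = (\<Sum>k\<in>UNIV. P $ i $ k * cnj (P $ i $ k))"
        by (simp add: matrix_matrix_mult_def herm)
      also have "\<dots> = of_real (\<Sum>k\<in>UNIV. (cmod (P $ i $ k))\<^sup>2)"
        by (simp add: complex_norm_square del: of_real_power)
      finally show ?thesis by (simp add: sum_nonneg)
    qed
    hence "Re (trace P) \<ge> 0" by (simp add: trace_def sum_nonneg)
    with 0(3) show ?case by simp
  next
    case (Suc m P)
    have herm: "cnj (P $ j $ i) = P $ i $ j" for i j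
      using Suc.prems(1) by (auto simp: hermitian_matrix_def conj_transpose_def vec_eq_iff)
    show ?case
    proof (cases "P = 0")
      case True
      thus ?thesis by (intro exI[of _ 0]) (simp add: trace_def)
    next
      case False
      then obtain a b where ab: "P $ a $ b \<noteq> 0" by (auto simp: vec_eq_iff)
      define r where "r = sqrt (\<Sum>i\<in>UNIV. (cmod (P $ i $ b))\<^sup>2)"
      have "0 < (\<Sum>i\<in>UNIV. (cmod (P $ i $ b))\<^sup>2)"
        using ab by (intro sum_pos2[of _ a]) auto
      hence r: "r > 0" "r\<^sup>2 = (\<Sum>i\<in>UNIV. (cmod (P $ i $ b))\<^sup>2)"
        by (auto simp: r_def)
      define v where "v = (\<chi> i. P $ i $ b / of_real r)"
      have Pv: "(\<Sum>k\<in>UNIV. P $ i $ k * v $ k) = v $ i" for i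
      proof -
        have "(\<Sum>k\<in>UNIV. P $ i $ k * v $ k) = (P ** P) $ i $ b / of_real r"
          by (simp add: v_def matrix_matrix_mult_def sum_divide_distrib)
        thus ?thesis by (simp add: Suc.prems(2) v_def)
      qed
      have vP: "(\<Sum>k\<in>UNIV. cnj (v $ k) * P $ k $ j) = cnj (v $ j)" for j
      proof -
        have "cnj (v $ j) = cnj (\<Sum>k\<in>UNIV. P $ j $ k * v $ k)" by (simp add: Pv)
        also have "\<dots> = (\<Sum>k\<in>UNIV. cnj (v $ k) * P $ k $ j)"
          by (simp add: herm mult.commute)
        finally show ?thesis by simp
      qed
      have vv: "(\<Sum>k\<in>UNIV. cnj (v $ k) * v $ k) = 1"
      proof -
        have "(\<Sum>k\<in>UNIV. cnj (v $ k) * v $ k) = of_real (\<Sum>k\<in>UNIV. (cmod (v $ k))\<^sup>2)"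
          by (simp add: complex_norm_square mult.commute del: of_real_power)
        also have "(\<Sum>k\<in>UNIV. (cmod (v $ k))\<^sup>2) = r\<^sup>2 / r\<^sup>2"
          by (simp add: v_def norm_divide power_divide r(2) flip: sum_divide_distrib)
        finally show ?thesis using r(1) by simp
      qed
      let ?Q = "P - rank_one v"
      have "hermitian_matrix ?Q"
        by (simp add: hermitian_matrix_def conj_transpose_def vec_eq_iff herm rank_one_def mult.commute)
      moreover have "?Q ** ?Q = ?Q"
      proof -
        have "(?Q ** ?Q) $ i $ j = ?Q $ i $ j" for i j
        proof -
          have "(?Q ** ?Q) $ i $ j = (\<Sum>k\<in>UNIV. P $ i $ k * P $ k $ j
              - (P $ i $ k * v $ k) * cnj (v $ j) - v $ i * (cnj (v $ k) * P $ k $ j)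
              + v $ i * cnj (v $ j) * (cnj (v $ k) * v $ k))"
            unfolding matrix_matrix_mult_def rank_one_def
            by (simp add: algebra_simps)
          also have "\<dots> = (P ** P) $ i $ j - v $ i * cnj (v $ j) - v $ i * cnj (v $ j)
              + v $ i * cnj (v $ j)"
            by (simp only: sum.distrib sum_subtractf flip: sum_distrib_left sum_distrib_right)
              (simp add: Pv vP vv matrix_matrix_mult_def)
          finally show ?thesis by (simp add: Suc.prems(2) rank_one_def)
        qed
        thus ?thesis by (simp add: vec_eq_iff)
      qed
      moreover have tr: "trace ?Q = trace P - 1"
        using vv by (simp add: trace_def rank_one_def sum_subtractf mult.commute)
      moreover have "Re (trace ?Q) < real m" using Suc.prems(3) tr by simp
      ultimately obtain k :: nat where "trace ?Q = of_nat k" using Suc.IH by blast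
      hence "trace P = of_nat (Suc k)" using tr by (simp add: algebra_simps)
      thus ?thesis by blast
    qed
  qed
  obtain m :: nat where "Re (trace P) < real m" using reals_Archimedean2 by blast
  thus ?thesis using main assms by blast
qed

text \<open>Here \<open>d\<close> is the diagonal of \<open>U\<close>, and \<open>k\<close> is the trace of the projection \<open>(1 + U) / 2\<close>, the
  multiplicity of the eigenvalue 1 of \<open>U\<close>.\<close>

lemma H_unistochastic_diagonal:
  fixes M :: "real^'n^'n"
  assumes "H_unistochastic M"
  obtains d :: "'n \<Rightarrow> real" and k :: nat
  where "\<And>i. M $ i $ i = (d i)\<^sup>2" "(\<Sum>i\<in>UNIV. d i) = 2 * real k - real CARD('n)"
    "\<And>i. \<bar>d i\<bar> \<le> 1"
proof -
  obtain U :: "complex^'n^'n" where U: "hermitian_matrix U" "unitary_matrix U"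
      "\<And>i j. M $ i $ j = (cmod (U $ i $ j))\<^sup>2"
    using assms by (auto simp: H_unistochastic_def)
  have herm: "cnj (U $ j $ i) = U $ i $ j" for i j
    using U(1) by (auto simp: hermitian_matrix_def conj_transpose_def vec_eq_iff)
  have UU: "U ** U = mat 1" using U(1,2) by (simp add: hermitian_matrix_def unitary_matrix_def)
  let ?P = "(\<chi> i j. (mat 1 $ i $ j + U $ i $ j) / 2) :: complex^'n^'n"
  have "hermitian_matrix ?P"
    by (auto simp: hermitian_matrix_def conj_transpose_def vec_eq_iff herm mat_def)
  moreover have "?P ** ?P = ?P"
  proof -
    have "?P = (1/2) *\<^sub>R (mat 1 + U)" by (simp add: vec_eq_iff scaleR_conv_of_real[where 'a=complex])
    moreover have "((1/2) *\<^sub>R (mat 1 + U)) ** ((1/2) *\<^sub>R (mat 1 + U))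
        = (1/4) *\<^sub>R ((mat 1 + U) ** (mat 1 + U))"
      by (simp add: vec_eq_iff matrix_matrix_mult_def scaleR_sum_right)
    moreover have "(mat 1 + U) ** (mat 1 + U) = 2 *\<^sub>R (mat 1 + U)"
    proof -
      have "(mat 1 + U) ** U = mat 1 ** U + U ** U"
        by (simp only: matrix_matrix_mult_def vec_eq_iff)
          (simp add: distrib_right sum.distrib)
      hence "(mat 1 + U) ** (mat 1 + U) = (mat 1 + U) + (U + U ** U)"
        by (simp add: matrix_add_ldistrib)
      thus ?thesis by (simp add: UU scaleR_2 algebra_simps)
    qed
    ultimately show ?thesis by simp
  qed
  ultimately obtain k :: nat where k: "trace ?P = of_nat k" using trace_of_projection_nat by blast
  have "trace ?P = (of_nat CARD('n) + (\<Sum>i\<in>UNIV. U $ i $ i)) / 2"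
    by (simp add: trace_def mat_def sum.distrib flip: sum_divide_distrib)
  hence "(\<Sum>i\<in>UNIV. U $ i $ i) = 2 * of_nat k - of_nat CARD('n)"
    using k by (simp add: field_simps)
  hence "Re (\<Sum>i\<in>UNIV. U $ i $ i) = Re (2 * of_nat k - of_nat CARD('n))" by (rule arg_cong)
  hence sum: "(\<Sum>i\<in>UNIV. Re (U $ i $ i)) = 2 * real k - real CARD('n)" by simp
  have sq: "M $ i $ i = (Re (U $ i $ i))\<^sup>2" for i
  proof -
    have "Im (U $ i $ i) = 0" using herm[of i i] by (simp add: complex_eq_iff)
    thus ?thesis using U(3) by (simp add: cmod_power2)
  qed
  have bd: "\<bar>Re (U $ i $ i)\<bar> \<le> 1" for i
  proof -
    have "(Re (U $ i $ i))\<^sup>2 \<le> (\<Sum>j\<in>UNIV. M $ i $ j)"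
      unfolding sq[symmetric] by (rule member_le_sum) (auto simp: U(3))
    thus ?thesis using row_sum_of_H_unistochastic[OF assms] by (simp add: abs_square_le_1)
  qed
  show ?thesis by (rule that[OF sq sum bd])
qed


lemma diagonal_bound_on_Bh:
  fixes w :: "'n::finite \<Rightarrow> real"
  assumes "\<And>M. H_unistochastic M \<Longrightarrow> c \<le> (\<Sum>i\<in>UNIV. w i * M $ i $ i)"
    and "M \<in> Bh"
  shows "c \<le> (\<Sum>i\<in>UNIV. w i * M $ i $ i)"
proof -
  have eq: "(\<Sum>i\<in>UNIV. \<Sum>j\<in>UNIV. (if i = j then w i else 0) * N $ i $ j)
      = (\<Sum>i\<in>UNIV. w i * N $ i $ i)" for N :: "real^'n^'n"
  proof (rule sum.cong[OF refl])
    fix i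
    have "(\<Sum>j\<in>UNIV. (if i = j then w i else 0) * N $ i $ j)
        = (\<Sum>j\<in>UNIV. if i = j then w i * N $ i $ i else 0)"
      by (rule sum.cong) auto
    thus "(\<Sum>j\<in>UNIV. (if i = j then w i else 0) * N $ i $ j) = w i * N $ i $ i" by simp
  qed
  have "c \<le> (\<Sum>i\<in>UNIV. \<Sum>j\<in>UNIV. (if i = j then w i else 0) * M $ i $ j)"
    by (rule entry_sum_bound_on_Bh[OF _ assms(2)]) (simp only: eq assms(1))
  thus ?thesis by (simp only: eq)
qed

text \<open>Three reals whose sum is an odd integer have squares adding up to at least 1/3.\<close>

lemma diagonal_bound_3:
  fixes a b c :: "'n::finite"
  assumes U: "UNIV = {a, b, c}" "distinct [a, b, c]" and "M \<in> Bh"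
  shows "1 / 3 \<le> M $ a $ a + M $ b $ b + M $ c $ c"
proof -
  have card: "CARD('n) = 3" by (subst U(1)) (use U(2) in simp)
  have sumU: "sum f UNIV = f a + f b + f c" for f :: "'n \<Rightarrow> real"
    by (subst U(1)) (use U(2) in \<open>simp add: add.assoc\<close>)
  have "1 / 3 \<le> (\<Sum>i\<in>UNIV. 1 * M $ i $ i)"
  proof (rule diagonal_bound_on_Bh[OF _ assms(3)])
    fix N :: "real^'n^'n" assume "H_unistochastic N"
    then obtain d :: "'n \<Rightarrow> real" and k :: nat where d: "\<And>i. N $ i $ i = (d i)\<^sup>2"
      "(\<Sum>i\<in>UNIV. d i) = 2 * real k - real CARD('n)"
      using H_unistochastic_diagonal by metis
    have "1 \<le> (2 * int k - 3)\<^sup>2"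
    proof -
      have "2 * int k - 3 \<noteq> 0" by presburger
      thus ?thesis by (simp add: int_one_le_iff_zero_less)
    qed
    hence "real_of_int 1 \<le> real_of_int ((2 * int k - 3)\<^sup>2)" by (simp only: of_int_le_iff)
    hence "1 \<le> (d a + d b + d c)\<^sup>2" using d(2) card by (simp add: sumU)
    moreover have "(d a + d b + d c)\<^sup>2 \<le> 3 * ((d a)\<^sup>2 + (d b)\<^sup>2 + (d c)\<^sup>2)"
      using sum_power2_ge_zero[of "d a - d b" "d b - d c"] zero_le_power2[of "d a - d c"]
      by (simp add: power2_eq_square algebra_simps)
    ultimately show "1 / 3 \<le> (\<Sum>i\<in>UNIV. 1 * N $ i $ i)" by (simp add: d(1) sumU)
  qed
  thus ?thesis by (simp add: sumU)
qed

text \<open>An even integer minus a real \<open>q\<close> with \<open>\<bar>q\<bar> \<le> 1\<close> has modulus at least \<open>\<bar>q\<bar>\<close>; apply this to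
  \<open>q = d\<^sub>4\<close> and the even trace, then Cauchy--Schwarz to the other three diagonal entries.\<close>

lemma diagonal_bound_4:
  fixes a b c d :: "'n::finite"
  assumes U: "UNIV = {a, b, c, d}" "distinct [a, b, c, d]" and "M \<in> Bh"
  shows "M $ d $ d \<le> 3 * (M $ a $ a + M $ b $ b + M $ c $ c)"
proof -
  have card: "CARD('n) = 4" by (subst U(1)) (use U(2) in simp)
  have sumU: "sum f UNIV = f a + f b + f c + f d" for f :: "'n \<Rightarrow> real"
    by (subst U(1)) (use U(2) in \<open>simp add: add.assoc\<close>)
  have "0 \<le> (\<Sum>i\<in>UNIV. (if i = d then -1 else 3) * M $ i $ i)"
  proof (rule diagonal_bound_on_Bh[OF _ assms(3)])
    fix N :: "real^'n^'n" assume "H_unistochastic N"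
    then obtain e :: "'n \<Rightarrow> real" and k :: nat where e: "\<And>i. N $ i $ i = (e i)\<^sup>2"
      "(\<Sum>i\<in>UNIV. e i) = 2 * real k - real CARD('n)" "\<And>i. \<bar>e i\<bar> \<le> 1"
      using H_unistochastic_diagonal by metis
    \<comment> \<open>\<open>m\<close> is half the trace; it is an integer.\<close>
    define q where "q = e d"
    define m where "m = real k - 2"
    have s: "e a + e b + e c = 2 * m - q" using e(2) card by (simp add: sumU m_def q_def)
    have q: "-1 \<le> q" "q \<le> 1" using e(3)[of d] by (auto simp: q_def)
    have "0 \<le> m * (m - q)"
    proof -
      have "k \<le> 1 \<or> k = 2 \<or> k \<ge> 3" by linarith
      hence "m \<le> -1 \<or> m = 0 \<or> m \<ge> 1" unfolding m_def by auto
      thus ?thesis using q by (auto simp: zero_le_mult_iff)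
    qed
    hence "q\<^sup>2 \<le> (e a + e b + e c)\<^sup>2" unfolding s by (simp add: power2_eq_square algebra_simps)
    moreover have "(e a + e b + e c)\<^sup>2 \<le> 3 * ((e a)\<^sup>2 + (e b)\<^sup>2 + (e c)\<^sup>2)"
      using sum_power2_ge_zero[of "e a - e b" "e b - e c"] zero_le_power2[of "e a - e c"]
      by (simp add: power2_eq_square algebra_simps)
    ultimately show "0 \<le> (\<Sum>i\<in>UNIV. (if i = d then -1 else 3) * N $ i $ i)"
      using U(2) by (simp add: e(1) sumU q_def)
  qed
  thus ?thesis using U(2) by (simp add: sumU)
qed

section \<open>Fractional matchings on a star, a triangle and a tetrahedron\<close>

text \<open>In the next three lemmas \<open>e\<close> is the identity matrix, and \<open>p\<close>, \<open>q\<close>, \<open>r\<close> (with or without a prime) are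
  Laplacians of edges of a graph with weights \<open>x\<close>, \<open>y\<close>, \<open>z\<close>; but only the linear relations between the
  generators matter. Working in a cone rather than a convex set leaves the common row sum \<open>s\<close> free,
  so that parts of a decomposition need not be normalised. The hypothesis \<open>x + y + z \<le> s\<close> bounds the total
  weight at the centre of the star.\<close>

lemma star_in_cone:
  fixes C :: "'a::real_vector set"
  assumes C: "convex_cone C" "e \<in> C" "e - p \<in> C" "e - q \<in> C" "e - r \<in> C"
    and nn: "0 \<le> x" "0 \<le> y" "0 \<le> z" "x + y + z \<le> s"
  shows "s *\<^sub>R e - x *\<^sub>R p - y *\<^sub>R q - z *\<^sub>R r \<in> C"
proof -
  have "(s - x - y - z) *\<^sub>R e + x *\<^sub>R (e - p) + y *\<^sub>R (e - q) + z *\<^sub>R (e - r) \<in> C"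
    using nn by (intro convex_cone_add[OF C(1)] convex_cone_scaleR[OF C(1)] C) auto
  thus ?thesis by (simp add: algebra_simps)
qed

text \<open>The three upper bounds are the weights at the vertices of the triangle. If the total weight
  is at most \<open>s\<close>, single edges suffice, as for a star. Otherwise the excess \<open>x + y + z - s\<close> is the
  weight taken from every edge by the half triangle \<open>e - (p + q + r) / 2\<close>, whose coefficient is
  therefore twice the excess; the remaining weight of each edge is the slack at its opposite vertex.\<close>

lemma triangle_in_cone:
  fixes C :: "'a::real_vector set"
  assumes C: "convex_cone C" "e \<in> C" "e - p \<in> C" "e - q \<in> C" "e - r \<in> C"
      "e - (1/2) *\<^sub>R (p + q + r) \<in> C"
    and nn: "0 \<le> x" "0 \<le> y" "0 \<le> z" "x + y \<le> s" "x + z \<le> s" "y + z \<le> s"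
  shows "s *\<^sub>R e - x *\<^sub>R p - y *\<^sub>R q - z *\<^sub>R r \<in> C"
proof (cases "x + y + z \<le> s")
  case True
  thus ?thesis by (intro star_in_cone C nn)
next
  case False
  have "(s - y - z) *\<^sub>R (e - p) + (s - x - z) *\<^sub>R (e - q) + (s - x - y) *\<^sub>R (e - r)
      + (2 * (x + y + z - s)) *\<^sub>R (e - (1/2) *\<^sub>R (p + q + r)) \<in> C"
    using nn False by (intro convex_cone_add[OF C(1)] convex_cone_scaleR[OF C(1)] C) auto
  also have "(s - y - z) *\<^sub>R (e - p) + (s - x - z) *\<^sub>R (e - q) + (s - x - y) *\<^sub>R (e - r)
      + (2 * (x + y + z - s)) *\<^sub>R (e - (1/2) *\<^sub>R (p + q + r))
      = s *\<^sub>R e - x *\<^sub>R p - y *\<^sub>R q - z *\<^sub>R r"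
  proof -
    have "(2 * t) *\<^sub>R (e - (1/2) *\<^sub>R (p + q + r)) = (2 * t) *\<^sub>R e - t *\<^sub>R (p + q + r)" for t :: real
      by (simp add: scaleR_diff_right)
    hence h: "(2 * (x + y + z - s)) *\<^sub>R (e - (1/2) *\<^sub>R (p + q + r))
      = (2 * (x + y + z - s)) *\<^sub>R e - (x + y + z - s) *\<^sub>R (p + q + r)" .
    show ?thesis unfolding h by (simp add: algebra_simps flip: scaleR_2 mult_2)
  qed
  finally show ?thesis .
qed

text \<open>The pairs \<open>p, p'\<close> and \<open>q, q'\<close> and \<open>r, r'\<close> are opposite edges of the tetrahedron, that is, its
  perfect matchings. Choosing one edge of each pair gives the four stars (choices with an even number of
  primes) and the four triangles (an odd number). After the smaller weight of each
  opposite pair is split off together with the perfect matching, only such a choice remains. A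
  perfect matching contributes equally at every vertex, so the bounds at the vertices persist.\<close>

lemma tetrahedron_in_cone:
  fixes C :: "'a::real_vector set"
  assumes C: "convex_cone C" "e \<in> C"
      "e - p \<in> C" "e - p' \<in> C" "e - q \<in> C" "e - q' \<in> C" "e - r \<in> C" "e - r' \<in> C"
      "e - p - p' \<in> C" "e - q - q' \<in> C" "e - r - r' \<in> C"
      "e - (1/2) *\<^sub>R (p + q + r') \<in> C" "e - (1/2) *\<^sub>R (p + q' + r) \<in> C"
      "e - (1/2) *\<^sub>R (p' + q + r) \<in> C" "e - (1/2) *\<^sub>R (p' + q' + r') \<in> C"
    and nn: "0 \<le> x" "0 \<le> x'" "0 \<le> y" "0 \<le> y'" "0 \<le> z" "0 \<le> z'"
    and deg: "x + y + z \<le> s" "x + y' + z' \<le> s" "x' + y + z' \<le> s" "x' + y' + z \<le> s"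
  shows "s *\<^sub>R e - x *\<^sub>R p - x' *\<^sub>R p' - y *\<^sub>R q - y' *\<^sub>R q' - z *\<^sub>R r - z' *\<^sub>R r' \<in> C"
proof -
  \<comment> \<open>The case in which one weight of each opposite pair vanishes.\<close>
  have reduced: "t *\<^sub>R e - u *\<^sub>R p - u' *\<^sub>R p' - v *\<^sub>R q - v' *\<^sub>R q' - w *\<^sub>R r - w' *\<^sub>R r' \<in> C"
    if nn: "0 \<le> u" "0 \<le> u'" "0 \<le> v" "0 \<le> v'" "0 \<le> w" "0 \<le> w'"
    and deg: "u + v + w \<le> t" "u + v' + w' \<le> t" "u' + v + w' \<le> t" "u' + v' + w \<le> t"
    and zero: "u = 0 \<or> u' = 0" "v = 0 \<or> v' = 0" "w = 0 \<or> w' = 0"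
    for t u u' v v' w w' :: real
  proof -
    note star = star_in_cone[OF C(1,2)] and triangle = triangle_in_cone[OF C(1,2)]
    consider "u' = 0" "v' = 0" "w' = 0" | "u' = 0" "v = 0" "w = 0"
      | "u = 0" "v' = 0" "w = 0" | "u = 0" "v = 0" "w' = 0"
      | "u' = 0" "v' = 0" "w = 0" | "u' = 0" "v = 0" "w' = 0"
      | "u = 0" "v' = 0" "w' = 0" | "u = 0" "v = 0" "w = 0"
      using zero by blast
    thus ?thesis
    proof cases
      case 1 thus ?thesis using star[OF C(3,5,7), of u v w t] nn deg by simp
    next
      case 2 thus ?thesis using star[OF C(3,6,8), of u v' w' t] nn deg by simp
    next
      case 3 thus ?thesis using star[OF C(4,5,8), of u' v w' t] nn deg by simp
    next
      case 4 thus ?thesis using star[OF C(4,6,7), of u' v' w t] nn deg by simp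
    next
      case 5 thus ?thesis using triangle[OF C(3,5,8,12), of u v w' t] nn deg by simp
    next
      case 6 thus ?thesis using triangle[OF C(3,6,7,13), of u v' w t] nn deg by simp
    next
      case 7 thus ?thesis using triangle[OF C(4,5,7,14), of u' v w t] nn deg by simp
    next
      case 8 thus ?thesis using triangle[OF C(4,6,8,15), of u' v' w' t] nn deg by simp
    qed
  qed
  define m1 m2 m3 where "m1 = min x x'" and "m2 = min y y'" and "m3 = min z z'"
  have "(s - m1 - m2 - m3) *\<^sub>R e - (x - m1) *\<^sub>R p - (x' - m1) *\<^sub>R p'
      - (y - m2) *\<^sub>R q - (y' - m2) *\<^sub>R q' - (z - m3) *\<^sub>R r - (z' - m3) *\<^sub>R r' \<in> C"
    by (rule reduced) (use deg in \<open>auto simp: m1_def m2_def m3_def min_def\<close>)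
  moreover have "m1 *\<^sub>R (e - p - p') + m2 *\<^sub>R (e - q - q') + m3 *\<^sub>R (e - r - r') \<in> C"
    using nn by (intro convex_cone_add[OF C(1)] convex_cone_scaleR[OF C(1)] C)
      (auto simp: m1_def m2_def m3_def)
  ultimately have "(s - m1 - m2 - m3) *\<^sub>R e - (x - m1) *\<^sub>R p - (x' - m1) *\<^sub>R p'
      - (y - m2) *\<^sub>R q - (y' - m2) *\<^sub>R q' - (z - m3) *\<^sub>R r - (z' - m3) *\<^sub>R r'
      + (m1 *\<^sub>R (e - p - p') + m2 *\<^sub>R (e - q - q') + m3 *\<^sub>R (e - r - r')) \<in> C"
    by (rule convex_cone_add[OF C(1)])
  thus ?thesis by (simp add: algebra_simps)
qed

section \<open>Matchings and half triangles as matrices\<close>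

text \<open>This is \<open>(e\<^sub>a - e\<^sub>b) (e\<^sub>a - e\<^sub>b)\<^sup>T\<close>, the Laplacian of the graph with the single edge \<open>ab\<close>;
  subtracting it from the identity gives the transposition matrix of \<open>a\<close> and \<open>b\<close>.\<close>

definition edge_laplacian :: "'n \<Rightarrow> 'n \<Rightarrow> real^'n^'n" where
  "edge_laplacian a b = (\<chi> i j. (of_bool (i = a) - of_bool (i = b)) * (of_bool (j = a) - of_bool (j = b)))"

lemma mat_1_in_Bh: "mat 1 \<in> Bh"
proof -
  have "(mat 1 :: real^'a^'a) = (\<chi> i j. if j = id i then 1 else 0)"
    by (auto simp: vec_eq_iff mat_def)
  also have "\<dots> \<in> Bh" by (rule involution_matrix_in_Bh) simp
  finally show ?thesis .
qed

lemma swap_in_Bh: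
  assumes "a \<noteq> b" shows "mat 1 - edge_laplacian a b \<in> Bh"
proof -
  have "mat 1 - edge_laplacian a b = (\<chi> i j. if j = (id(a := b, b := a)) i then 1 else 0)"
    using assms by (auto simp: vec_eq_iff mat_def edge_laplacian_def)
  thus ?thesis using involution_matrix_in_Bh[of "id(a := b, b := a)"] assms by simp
qed

lemma double_swap_in_Bh:
  assumes "distinct [a, b, c, d]" shows "mat 1 - edge_laplacian a b - edge_laplacian c d \<in> Bh"
proof -
  define p where "p = id(a := b, b := a, c := d, d := c)"
  have "mat 1 - edge_laplacian a b - edge_laplacian c d = (\<chi> i j. if j = p i then 1 else 0)"
    using assms by (auto simp: vec_eq_iff mat_def edge_laplacian_def p_def)
  moreover have "p (p i) = i" for i using assms by (auto simp: p_def)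
  ultimately show ?thesis using involution_matrix_in_Bh[of p] by simp
qed

text \<open>The average of the two 3-cycles on \<open>a, b, c\<close>: an extreme symmetric bistochastic
  matrix that is not a permutation matrix. For \<open>n = 3\<close> and \<open>n = 4\<close> it forces the constant down to 2/3.\<close>

definition half_triangle :: "'n \<Rightarrow> 'n \<Rightarrow> 'n \<Rightarrow> real^'n^'n" where
  "half_triangle a b c = mat 1 - (1/2) *\<^sub>R (edge_laplacian a b + edge_laplacian a c + edge_laplacian b c)"

lemma half_triangle_nth:
  assumes "distinct [a, b, c]"
  shows "half_triangle a b c $ i $ j =
    (if i \<in> {a, b, c} \<and> j \<in> {a, b, c} then if i = j then 0 else 1 / 2 else if i = j then 1 else 0)"
proof -
  have ne: "a \<noteq> b" "a \<noteq> c" "b \<noteq> c" "b \<noteq> a" "c \<noteq> a" "c \<noteq> b" using assms by auto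
  have "i = a \<or> i = b \<or> i = c \<or> i \<noteq> a \<and> i \<noteq> b \<and> i \<noteq> c"
    "j = a \<or> j = b \<or> j = c \<or> j \<noteq> a \<and> j \<noteq> b \<and> j \<noteq> c" by blast+
  thus ?thesis
    by (elim disjE conjE; simp add: half_triangle_def edge_laplacian_def mat_def ne)
qed

lemma symmetric_bistochastic_half_triangle:
  assumes "distinct [a, b, c]"
  shows "symmetric_bistochastic (half_triangle a b c)"
proof -
  have sym: "half_triangle a b c $ i $ j = half_triangle a b c $ j $ i" for i j
    unfolding half_triangle_nth[OF assms] by auto
  have nonneg: "0 \<le> half_triangle a b c $ i $ j" for i j
    unfolding half_triangle_nth[OF assms] by auto
  have laplacian_row: "(\<Sum>j\<in>UNIV. edge_laplacian x y $ i $ j) = 0" for x y i :: 'a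
    by (simp add: edge_laplacian_def sum_subtractf of_bool_def flip: sum_distrib_left)
  have row: "(\<Sum>j\<in>UNIV. half_triangle a b c $ i $ j) = 1" for i
  proof -
    have "(\<Sum>j\<in>UNIV. half_triangle a b c $ i $ j) = (\<Sum>j\<in>UNIV. mat 1 $ i $ j)
        - (1/2) * ((\<Sum>j\<in>UNIV. edge_laplacian a b $ i $ j) + (\<Sum>j\<in>UNIV. edge_laplacian a c $ i $ j)
          + (\<Sum>j\<in>UNIV. edge_laplacian b c $ i $ j))"
      by (simp add: half_triangle_def sum_subtractf sum.distrib sum_divide_distrib add_divide_distrib)
    thus ?thesis by (simp add: laplacian_row mat_def)
  qed
  have col: "(\<Sum>i\<in>UNIV. half_triangle a b c $ i $ j) = 1" for j
    using row[of j] by (simp only: sym[of _ j])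
  show ?thesis
    using nonneg row col sym
    by (auto simp: symmetric_bistochastic_def bistochastic_def transpose_def vec_eq_iff)
qed

text \<open>The witness is the reflection \<open>1 - (2/3) J\<close>, with \<open>J\<close> the all-ones matrix.\<close>

lemma shrunk_half_triangle_in_Bh_3:
  fixes a b c :: "'n::finite"
  assumes U: "UNIV = {a, b, c}" "distinct [a, b, c]"
  shows "(2/3) *\<^sub>R half_triangle a b c + (1/3) *\<^sub>R W_matrix \<in> Bh"
proof (rule H_unistochastic_imp_Bh, rule H_unistochasticI)
  have card: "CARD('n) = 3" by (subst U(1)) (use U(2) in simp)
  have sumU: "sum f UNIV = f a + f b + f c" for f :: "'n \<Rightarrow> complex"
    by (subst U(1)) (use U(2) in \<open>simp add: add.assoc\<close>)
  have rev: "distinct [c, b, a]" using U(2) by auto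
  have all: "(\<forall>i. P i) \<longleftrightarrow> P a \<and> P b \<and> P c" for P
    using U(1) by (metis UNIV_I insertE singletonD)
  let ?U = "(\<chi> i j. of_real (if i = j then 1/3 else -2/3)) :: complex^'n^'n"
  show "cnj (?U $ j $ i) = ?U $ i $ j" for i j by simp
  have "\<forall>i j. (\<Sum>k\<in>UNIV. ?U $ i $ k * ?U $ k $ j) = (if i = j then 1 else 0)"
    unfolding all sumU using U(2) rev by simp
  thus "(\<Sum>k\<in>UNIV. ?U $ i $ k * ?U $ k $ j) = (if i = j then 1 else 0)" for i j by blast
  show "((2/3) *\<^sub>R half_triangle a b c + (1/3) *\<^sub>R W_matrix) $ i $ j = (cmod (?U $ i $ j))\<^sup>2" for i j
  proof -
    have "i \<in> {a, b, c}" "j \<in> {a, b, c}" unfolding U(1)[symmetric] by simp_all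
    hence "half_triangle a b c $ i $ j = (if i = j then 0 else 1 / 2)"
      by (simp only: half_triangle_nth[OF U(2)] conj_absorb if_True)
    thus ?thesis by (simp add: W_matrix_def card power2_eq_square norm_divide norm_mult)
  qed
qed

text \<open>The squared moduli are 1/12 on the diagonal of the block and along the border, 5/12 off the
  diagonal of the block, and 3/4 in the corner. Equality in the diagonal bound forces trace 0, which
  fixes the diagonal up to a sign. With last row \<open>(1, 1, 1, 3) / sqrt 12\<close> and a circulant Hermitian
  block, orthogonality to the last row says that the off-diagonal entries \<open>z\<close> of the block have
  real part \<open>-1 / sqrt 12\<close>; hence \<open>z = (-1 + 2 \<i>) / sqrt 12\<close> up to conjugation.\<close>

lemma shrunk_half_triangle_in_Bh_4:
  fixes a b c d :: "'n::finite"
  assumes U: "UNIV = {a, b, c, d}" "distinct [a, b, c, d]"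
  shows "(2/3) *\<^sub>R half_triangle a b c + (1/3) *\<^sub>R W_matrix \<in> Bh"
proof (rule H_unistochastic_imp_Bh, rule H_unistochasticI)
  have card: "CARD('n) = 4" by (subst U(1)) (use U(2) in simp)
  have sumU: "sum f UNIV = f a + f b + f c + f d" for f :: "'n \<Rightarrow> complex"
    by (subst U(1)) (use U(2) in \<open>simp add: add.assoc\<close>)
  have rev: "distinct [d, c, b, a]" using U(2) by auto
  have all: "(\<forall>i. P i) \<longleftrightarrow> P a \<and> P b \<and> P c \<and> P d" for P
    using U(1) by (metis UNIV_I insertE singletonD)
  define G :: "'n \<Rightarrow> 'n \<Rightarrow> complex" where "G i j =
    (if i = j then (if i = d then 3 else -1) else if i = d \<or> j = d then 1
     else if (i, j) \<in> {(a, b), (b, c), (c, a)} then Complex (-1) 2 else Complex (-1) (-2))" for i j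
  let ?U = "(\<chi> i j. G i j / of_real (sqrt 12)) :: complex^'n^'n"
  have herm: "\<forall>i j. cnj (G j i) = G i j"
    unfolding all using U(2) rev by (simp add: G_def complex_eq_iff)
  show "cnj (?U $ j $ i) = ?U $ i $ j" for i j using herm by simp
  have sq: "\<forall>i j. (\<Sum>k\<in>UNIV. G i k * G k j) = (if i = j then 12 else 0)"
    unfolding all sumU using U(2) rev by (simp add: G_def complex_eq_iff)
  show "(\<Sum>k\<in>UNIV. ?U $ i $ k * ?U $ k $ j) = (if i = j then 1 else 0)" for i j
  proof -
    have "(\<Sum>k\<in>UNIV. ?U $ i $ k * ?U $ k $ j)
        = (\<Sum>k\<in>UNIV. G i k * G k j) / of_real (sqrt 12 * sqrt 12)"
      unfolding sum_divide_distrib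
      by (simp only: vec_lambda_beta times_divide_times_eq of_real_mult)
    also have "\<dots> = (if i = j then 12 else 0) / of_real (sqrt 12 * sqrt 12)"
      using sq by simp
    also have "\<dots> = (if i = j then 1 else 0)"
      by (subst real_sqrt_mult_self) simp
    finally show ?thesis .
  qed
  have "\<forall>i j. ((2/3) *\<^sub>R half_triangle a b c + (1/3) *\<^sub>R W_matrix) $ i $ j = (cmod (G i j))\<^sup>2 / 12"
    unfolding all using U(2) rev
    by (simp add: half_triangle_def edge_laplacian_def W_matrix_def mat_def card G_def cmod_power2)
  thus "((2/3) *\<^sub>R half_triangle a b c + (1/3) *\<^sub>R W_matrix) $ i $ j = (cmod (?U $ i $ j))\<^sup>2" for i j
    by (simp add: norm_divide power_divide)
qed

section \<open>The values for small n\<close>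

text \<open>The matrices \<open>N\<close> with \<open>t N + (1 - t) W\<close> in the hull form a convex set of matrices with unit row
  sums. A matrix with unit row sums in the cone over this set is a multiple \<open>r N\<close> of a member, and the
  row sums force \<open>r = 1\<close>. So it suffices to decompose \<open>M\<close> inside convex cones, where weights need
  not be normalised.\<close>

lemma admissible_if_in_every_cone:
  assumes t: "0 < t" "t \<le> 1"
    and gen: "\<And>M (C :: (real^'n^'n) set). \<lbrakk>symmetric_bistochastic M; convex_cone C;
        \<And>N. t *\<^sub>R N + (1 - t) *\<^sub>R W_matrix \<in> Bh \<Longrightarrow> N \<in> C\<rbrakk> \<Longrightarrow> M \<in> C"
  shows "t \<in> admissible_constants TYPE('n::finite)"
proof -
  let ?S = "{N :: real^'n^'n. t *\<^sub>R N + (1 - t) *\<^sub>R W_matrix \<in> Bh}"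
  have "t *\<^sub>R M + (1 - t) *\<^sub>R W_matrix \<in> Bh" if M: "symmetric_bistochastic M" for M :: "real^'n^'n"
  proof -
    have conv: "convex ?S"
    proof (rule convexI)
      fix N N' :: "real^'n^'n" and u v :: real
      assume N: "N \<in> ?S" "N' \<in> ?S" and uv: "0 \<le> u" "0 \<le> v" "u + v = 1"
      have "u *\<^sub>R (t *\<^sub>R N + (1 - t) *\<^sub>R W_matrix) + v *\<^sub>R (t *\<^sub>R N' + (1 - t) *\<^sub>R W_matrix) \<in> Bh"
        using convexD[OF convex_Bh] N uv by blast
      also have "u *\<^sub>R (t *\<^sub>R N + (1 - t) *\<^sub>R W_matrix) + v *\<^sub>R (t *\<^sub>R N' + (1 - t) *\<^sub>R W_matrix)
          = t *\<^sub>R (u *\<^sub>R N + v *\<^sub>R N') + ((u + v) * (1 - t)) *\<^sub>R W_matrix"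
        by (simp add: scaleR_add_right mult.commute[of _ t] distrib_right scaleR_add_left)
      finally show "u *\<^sub>R N + v *\<^sub>R N' \<in> ?S" using uv by simp
    qed
    have ne: "W_matrix \<in> ?S" by (simp add: W_matrix_in_Bh flip: scaleR_add_left)
    have "M \<in> convex_cone hull ?S"
      by (rule gen[OF M convex_cone_convex_cone_hull]) (simp add: hull_inc)
    moreover have "convex hull ?S = ?S" using conv by (rule hull_same)
    moreover have "?S \<noteq> {}" using ne by blast
    ultimately obtain r N where r: "M = r *\<^sub>R N" "N \<in> ?S"
      using convex_cone_hull_convex_hull_nonempty[of ?S] by auto
    have "(\<Sum>j\<in>UNIV. (t *\<^sub>R N + (1 - t) *\<^sub>R W_matrix) $ i $ j) = 1"
      by (rule row_sum_of_Bh) (use r(2) in simp)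
    hence "t * (\<Sum>j\<in>UNIV. N $ i $ j) + (1 - t) = 1"
      by (simp add: sum.distrib W_matrix_def flip: sum_distrib_left)
    hence "(\<Sum>j\<in>UNIV. N $ i $ j) = 1" using t by simp
    moreover have "(\<Sum>j\<in>UNIV. M $ i $ j) = 1"
      using M by (simp add: symmetric_bistochastic_def bistochastic_def)
    ultimately have "r = 1" by (simp add: r(1) flip: sum_distrib_left)
    thus ?thesis using r by simp
  qed
  thus ?thesis using t by (simp add: admissible_constants_def)
qed

lemma shrink_in_Bh:
  "N \<in> Bh \<Longrightarrow> 0 \<le> t \<Longrightarrow> t \<le> 1 \<Longrightarrow> t *\<^sub>R N + (1 - t) *\<^sub>R W_matrix \<in> Bh"
  by (intro convexD[OF convex_Bh _ W_matrix_in_Bh]) auto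

lemma symmetric_bistochasticD:
  assumes "symmetric_bistochastic M"
  shows "0 \<le> M $ i $ j" "(\<Sum>j\<in>UNIV. M $ i $ j) = 1" "M $ i $ j = M $ j $ i"
proof -
  have "transpose M $ j $ i = M $ j $ i" using assms by (simp add: symmetric_bistochastic_def)
  thus "M $ i $ j = M $ j $ i" by (simp add: transpose_def)
qed (use assms in \<open>auto simp: symmetric_bistochastic_def bistochastic_def\<close>)

lemma admissible_le_1: "t \<in> admissible_constants TYPE('n::finite) \<Longrightarrow> t \<le> 1"
  by (simp add: admissible_constants_def)

lemma ex_distinct_3:
  assumes "card A = 3" shows "\<exists>a b c. A = {a, b, c} \<and> distinct [a, b, c]"
  using assms by (auto simp: card_3_iff)

lemma ex_distinct_4:
  assumes "card A = 4" shows "\<exists>a b c d. A = {a, b, c, d} \<and> distinct [a, b, c, d]"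
proof -
  have "card A = Suc 3" using assms by simp
  then obtain a B where "A = insert a B" "a \<notin> B" "card B = 3"
    unfolding card_Suc_eq by iprover
  moreover obtain b c d where "B = {b, c, d}" "distinct [b, c, d]"
    using ex_distinct_3[OF \<open>card B = 3\<close>] by iprover
  ultimately have "A = {a, b, c, d} \<and> distinct [a, b, c, d]" by simp
  thus ?thesis by iprover
qed

lemma lambda_const_1:
  assumes "CARD('n::finite) = 1" shows "lambda_const TYPE('n) = 1"
proof (rule lambda_constI)
  obtain a :: 'n where U: "UNIV = {a}" using assms by (auto simp: card_1_singleton_iff)
  have all: "(\<forall>i. P i) \<longleftrightarrow> P a" for P using U by (metis UNIV_I singletonD)
  show "1 \<in> admissible_constants TYPE('n)"
  proof (rule admissible_if_in_every_cone)
    fix M :: "real^'n^'n" and C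
    assume M: "symmetric_bistochastic M"
      and C: "\<And>N :: real^'n^'n. 1 *\<^sub>R N + (1 - 1) *\<^sub>R W_matrix \<in> Bh \<Longrightarrow> N \<in> C"
    have "M = mat 1"
      unfolding vec_eq_iff all using symmetric_bistochasticD(2)[OF M, of a] unfolding U by (simp add: mat_def)
    thus "M \<in> C" using C[of "mat 1"] mat_1_in_Bh by simp
  qed auto
qed (rule admissible_le_1)

lemma lambda_const_2:
  assumes "CARD('n::finite) = 2" shows "lambda_const TYPE('n) = 1"
proof (rule lambda_constI)
  obtain a b :: 'n where U: "UNIV = {a, b}" "a \<noteq> b" using assms unfolding card_2_iff by iprover
  have rev: "b \<noteq> a" using U(2) by simp
  have all: "(\<forall>i. P i) \<longleftrightarrow> P a \<and> P b" for P using U by (metis UNIV_I insertE singletonD)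
  show "1 \<in> admissible_constants TYPE('n)"
  proof (rule admissible_if_in_every_cone)
    fix M :: "real^'n^'n" and C
    assume M: "symmetric_bistochastic M" and C: "convex_cone C"
      "\<And>N :: real^'n^'n. 1 *\<^sub>R N + (1 - 1) *\<^sub>R W_matrix \<in> Bh \<Longrightarrow> N \<in> C"
    note D = symmetric_bistochasticD[OF M]
    have rows: "M $ a $ a + M $ a $ b = 1" "M $ b $ a + M $ b $ b = 1"
      using D(2)[of a] D(2)[of b] U(2) unfolding U(1) by simp_all
    have "M = (M $ a $ a) *\<^sub>R mat 1 + (M $ a $ b) *\<^sub>R (mat 1 - edge_laplacian a b)"
      unfolding vec_eq_iff all using U(2) rev rows D(3)[of b a] by (simp add: mat_def edge_laplacian_def)
    also have "\<dots> \<in> C"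
      using C(2) D(1) mat_1_in_Bh swap_in_Bh[OF U(2)]
      by (intro convex_cone_add[OF C(1)] convex_cone_scaleR[OF C(1)]) auto
    finally show "M \<in> C" .
  qed auto
qed (rule admissible_le_1)

lemma lambda_const_3:
  assumes "CARD('n::finite) = 3" shows "lambda_const TYPE('n) = 2 / 3"
proof -
  obtain a b c :: 'n where U: "UNIV = {a, b, c}" and dist: "distinct [a, b, c]"
    using ex_distinct_3[OF assms] by iprover
  have rev: "distinct [c, b, a]" using dist by auto
  have all: "(\<forall>i. P i) \<longleftrightarrow> P a \<and> P b \<and> P c" for P using U by (metis UNIV_I insertE singletonD)
  show ?thesis
  proof (rule lambda_constI)
    show "2 / 3 \<in> admissible_constants TYPE('n)"
    proof (rule admissible_if_in_every_cone)
      fix M :: "real^'n^'n" and C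
      assume M: "symmetric_bistochastic M" and C: "convex_cone C"
        "\<And>N :: real^'n^'n. (2/3) *\<^sub>R N + (1 - 2/3) *\<^sub>R W_matrix \<in> Bh \<Longrightarrow> N \<in> C"
      have CB: "N \<in> C" if "N \<in> Bh" for N using C(2) shrink_in_Bh[OF that, of "2/3"] by simp
      note D = symmetric_bistochasticD[OF M]
      have rows: "M $ a $ a + M $ a $ b + M $ a $ c = 1" "M $ b $ a + M $ b $ b + M $ b $ c = 1"
        "M $ c $ a + M $ c $ b + M $ c $ c = 1"
        using D(2)[of a] D(2)[of b] D(2)[of c] dist unfolding U by (simp_all add: add.assoc)
      note symm = D(3)[of b a] D(3)[of c a] D(3)[of c b]
      have deg: "M $ a $ b + M $ a $ c \<le> 1" "M $ a $ b + M $ b $ c \<le> 1" "M $ a $ c + M $ b $ c \<le> 1"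
        using D(1)[of a a] D(1)[of b b] D(1)[of c c] rows symm by linarith+
      have "M = 1 *\<^sub>R mat 1 - (M $ a $ b) *\<^sub>R edge_laplacian a b - (M $ a $ c) *\<^sub>R edge_laplacian a c - (M $ b $ c) *\<^sub>R edge_laplacian b c"
        unfolding vec_eq_iff all using dist rev rows symm by (simp add: mat_def edge_laplacian_def)
      also have "\<dots> \<in> C"
      proof (rule triangle_in_cone[OF C(1)])
        show "mat 1 \<in> C" "mat 1 - edge_laplacian a b \<in> C" "mat 1 - edge_laplacian a c \<in> C" "mat 1 - edge_laplacian b c \<in> C"
          using dist by (auto intro!: CB mat_1_in_Bh swap_in_Bh)
        show "mat 1 - (1/2) *\<^sub>R (edge_laplacian a b + edge_laplacian a c + edge_laplacian b c) \<in> C"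
          using C(2) shrunk_half_triangle_in_Bh_3[OF U dist] by (simp add: half_triangle_def)
      qed (use D(1) deg in auto)
      finally show "M \<in> C" .
    qed auto
  next
    fix t assume "t \<in> admissible_constants TYPE('n)"
    hence "t *\<^sub>R half_triangle a b c + (1 - t) *\<^sub>R W_matrix \<in> Bh"
      using symmetric_bistochastic_half_triangle[OF dist] by (simp add: admissible_constants_def)
    note bound = diagonal_bound_3[OF U dist this]
    have H: "half_triangle a b c $ i $ i = 0" if "i \<in> {a, b, c}" for i
      using that by (simp add: half_triangle_nth[OF dist])
    have W: "(W_matrix :: real^'n^'n) $ i $ i = 1 / 3" for i
      using assms by (simp add: W_matrix_def)
    show "t \<le> 2 / 3"
      using bound H[of a] H[of b] H[of c]
      unfolding vector_add_component vector_scaleR_component real_scaleR_def W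
      by (simp add: field_simps)
  qed
qed

lemma lambda_const_4:
  assumes "CARD('n::finite) = 4" shows "lambda_const TYPE('n) = 2 / 3"
proof -
  obtain a b c d :: 'n where U: "UNIV = {a, b, c, d}" and dist: "distinct [a, b, c, d]"
    using ex_distinct_4[OF assms] by iprover
  have rev: "distinct [d, c, b, a]" using dist by auto
  have all: "(\<forall>i. P i) \<longleftrightarrow> P a \<and> P b \<and> P c \<and> P d" for P using U by (metis UNIV_I insertE singletonD)
  show ?thesis
  proof (rule lambda_constI)
    show "2 / 3 \<in> admissible_constants TYPE('n)"
    proof (rule admissible_if_in_every_cone)
      fix M :: "real^'n^'n" and C
      assume M: "symmetric_bistochastic M" and C: "convex_cone C"
        "\<And>N :: real^'n^'n. (2/3) *\<^sub>R N + (1 - 2/3) *\<^sub>R W_matrix \<in> Bh \<Longrightarrow> N \<in> C"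
      have CB: "N \<in> C" if "N \<in> Bh" for N using C(2) shrink_in_Bh[OF that, of "2/3"] by simp
      have CT: "mat 1 - (1/2) *\<^sub>R (edge_laplacian i j + edge_laplacian i k + edge_laplacian j k) \<in> C"
        if "UNIV = {i, j, k, l}" "distinct [i, j, k, l]" for i j k l
        using C(2) shrunk_half_triangle_in_Bh_4[OF that] by (simp add: half_triangle_def)
      note D = symmetric_bistochasticD[OF M]
      have rows: "M $ a $ a + M $ a $ b + M $ a $ c + M $ a $ d = 1"
        "M $ b $ a + M $ b $ b + M $ b $ c + M $ b $ d = 1"
        "M $ c $ a + M $ c $ b + M $ c $ c + M $ c $ d = 1"
        "M $ d $ a + M $ d $ b + M $ d $ c + M $ d $ d = 1"
        using D(2)[of a] D(2)[of b] D(2)[of c] D(2)[of d] dist unfolding U by (simp_all add: add.assoc)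
      note symm = D(3)[of b a] D(3)[of c a] D(3)[of c b] D(3)[of d a] D(3)[of d b] D(3)[of d c]
      have deg: "M $ a $ b + M $ a $ c + M $ a $ d \<le> 1" "M $ a $ b + M $ b $ d + M $ b $ c \<le> 1"
        "M $ c $ d + M $ a $ c + M $ b $ c \<le> 1" "M $ c $ d + M $ b $ d + M $ a $ d \<le> 1"
        using D(1)[of a a] D(1)[of b b] D(1)[of c c] D(1)[of d d] rows symm by linarith+
      have "M = 1 *\<^sub>R mat 1 - (M $ a $ b) *\<^sub>R edge_laplacian a b - (M $ c $ d) *\<^sub>R edge_laplacian c d
          - (M $ a $ c) *\<^sub>R edge_laplacian a c - (M $ b $ d) *\<^sub>R edge_laplacian b d
          - (M $ a $ d) *\<^sub>R edge_laplacian a d - (M $ b $ c) *\<^sub>R edge_laplacian b c"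
        unfolding vec_eq_iff all using dist rev rows symm by (simp add: mat_def edge_laplacian_def)
      also have "\<dots> \<in> C"
      proof (rule tetrahedron_in_cone[OF C(1)])
        show "mat 1 \<in> C" "mat 1 - edge_laplacian a b \<in> C" "mat 1 - edge_laplacian c d \<in> C" "mat 1 - edge_laplacian a c \<in> C"
          "mat 1 - edge_laplacian b d \<in> C" "mat 1 - edge_laplacian a d \<in> C" "mat 1 - edge_laplacian b c \<in> C"
          using dist by (auto intro!: CB mat_1_in_Bh swap_in_Bh)
        show "mat 1 - edge_laplacian a b - edge_laplacian c d \<in> C" "mat 1 - edge_laplacian a c - edge_laplacian b d \<in> C"
          "mat 1 - edge_laplacian a d - edge_laplacian b c \<in> C"
          using dist by (auto intro!: CB double_swap_in_Bh)
        show "mat 1 - (1/2) *\<^sub>R (edge_laplacian a b + edge_laplacian a c + edge_laplacian b c) \<in> C"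
          using dist U by (intro CT[of a b c d]) auto
        show "mat 1 - (1/2) *\<^sub>R (edge_laplacian a b + edge_laplacian b d + edge_laplacian a d) \<in> C"
          using CT[of a b d c] dist U by (auto simp: insert_commute add_ac)
        show "mat 1 - (1/2) *\<^sub>R (edge_laplacian c d + edge_laplacian a c + edge_laplacian a d) \<in> C"
          using CT[of a c d b] dist U by (auto simp: insert_commute add_ac)
        show "mat 1 - (1/2) *\<^sub>R (edge_laplacian c d + edge_laplacian b d + edge_laplacian b c) \<in> C"
          using CT[of b c d a] dist U by (auto simp: insert_commute add_ac)
      qed (use D(1) deg in auto)
      finally show "M \<in> C" .
    qed auto
  next
    fix t assume "t \<in> admissible_constants TYPE('n)"
    hence "t *\<^sub>R half_triangle a b c + (1 - t) *\<^sub>R W_matrix \<in> Bh"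
      using symmetric_bistochastic_half_triangle[of a b c] dist by (simp add: admissible_constants_def)
    note bound = diagonal_bound_4[OF U dist this]
    have H: "half_triangle a b c $ i $ i = (if i = d then 1 else 0)" for i
    proof -
      have "i \<in> {a, b, c, d}" using U by simp
      thus ?thesis using dist by (auto simp: half_triangle_nth)
    qed
    have W: "(W_matrix :: real^'n^'n) $ i $ i = 1 / 4" for i
      using assms by (simp add: W_matrix_def)
    show "t \<le> 2 / 3"
      using bound dist
      unfolding vector_add_component vector_scaleR_component real_scaleR_def W H
      by (simp add: field_simps)
  qed
qed

theorem theorem3:
  shows "lambda_const TYPE('n::finite) \<in> admissible_constants TYPE('n) \<and>
         (\<forall>t \<in> admissible_constants TYPE('n). t \<le> lambda_const TYPE('n)) \<and>
         (CARD('n) = 1 \<or> CARD('n) = 2 \<longrightarrow> lambda_const TYPE('n) = 1) \<and>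
         (CARD('n) = 3 \<or> CARD('n) = 4 \<longrightarrow> lambda_const TYPE('n) = 2 / 3)"
  using lambda_const_is_greatest lambda_const_1 lambda_const_2 lambda_const_3 lambda_const_4
  by blast

end
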